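(* Let $k$ be a positive integer and $\alpha$ an integer. Then, as formal power series in $q$, $$C\Phi_{k,\alpha}(q)=\frac{1}{(q;q)^k_{\infty}}\sum_{m_1,m_2,\dots,m_{k-1}=-\infty}^{\infty}q^{Q(m_1,\dots,m_{k-1})},$$ where $$Q(m_1,\dots,m_{k-1})=m_1^2+m_2^2+\cdots+m_{k-1}^2-\alpha(m_1+m_2+\cdots+m_{k-1})+\sum_{1\le i<j\le k-1}m_im_j+\frac{\alpha^2+\alpha}{2}.$$ (For $k=1$ the sum consists of the single term $q^{(\alpha^2+\alpha)/2}$.)
   Context: $(q;q)_\infty=\prod_{n=1}^\infty(1-q^n)$. For a positive integer $k$ and an integer $\alpha$, $C\Phi_{k,\alpha}(q)=\sum_{n\ge0}c\phi_{k,\alpha}(n)q^n$ is defined as the coefficient of $z^{\alpha}$ in the formal product $$\prod_{\lambda=0}^{\infty}(1+zq^{\lambda+1})^k(1+z^{-1}q^{\lambda})^k.$$ Combinatorially, $c\phi_{k,\alpha}(n)$ counts two-rowed arrays (top row with $m_1$ entries, bottom row with $m_2$ entries, row difference $m_1-m_2=\alpha$) whose entries are nonnegative integers each carrying one of $k$ colors, with no colored integer repeated within a row, and of weight $m_1+(\text{sum of all entries})=n$. *)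

theory Defs
  imports "HOL-Analysis.Analysis" "HOL-Computational_Algebra.Formal_Laurent_Series"
begin

text \<open>
  Infinite products and sums of formal power series are taken in the library topology on
  \<^typ>\<open>'a fps\<close>, where a family converges iff each coefficient is eventually constant.
  The coefficients are rational so that division by \<open>(q;q)\<^sub>\<infinity>\<close> is available as \<open>/\<close>.
\<close>

definition qpoch_inf :: "rat fps" where
  "qpoch_inf = (\<Prod>n. 1 - fps_X ^ (n + 1))"

text \<open>
  The product over \<open>\<lambda>\<close> lives in the power series in \<open>q\<close> over the Laurent series in \<open>z\<close>:
  \<^const>\<open>fps_X\<close> is \<open>q\<close>, and the constants \<^const>\<open>fls_X\<close>, \<^const>\<open>fls_X_inv\<close> are \<open>z\<close>, \<open>z\<^sup>-\<^sup>1\<close>.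
  Only finitely many factors contribute to a given power of \<open>q\<close>, so each coefficient is
  in fact a Laurent polynomial in \<open>z\<close>.
\<close>

definition frob_factor :: "nat \<Rightarrow> nat \<Rightarrow> rat fls fps" where
  "frob_factor k l =
     (1 + fps_const fls_X * fps_X ^ (l + 1)) ^ k * (1 + fps_const fls_X_inv * fps_X ^ l) ^ k"

definition frob_prod :: "nat \<Rightarrow> rat fls fps" where
  "frob_prod k = (\<Prod>l. frob_factor k l)"

definition CPhi :: "nat \<Rightarrow> int \<Rightarrow> rat fps" where
  "CPhi k \<alpha> = Abs_fps (\<lambda>n. fls_nth (fps_nth (frob_prod k) n) \<alpha>)"

text \<open>
  The division by 2 is exact, and the form is nonnegative (\<open>Q_form_nonneg\<close> below), so
  \<open>nat\<close> does not truncate when it is used as an exponent.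
\<close>

definition Q_form :: "nat \<Rightarrow> int \<Rightarrow> (nat \<Rightarrow> int) \<Rightarrow> int" where
  "Q_form k \<alpha> m =
     (\<Sum>i=1..k-1. (m i)\<^sup>2) - \<alpha> * (\<Sum>i=1..k-1. m i)
     + (\<Sum>i=1..k-1. \<Sum>j=i+1..k-1. m i * m j) + (\<alpha>\<^sup>2 + \<alpha>) div 2"

lemma has_prod_fpsI:
  fixes f :: "nat \<Rightarrow> 'a :: idom fps"
  assumes dvd: "\<And>l. fps_X ^ l dvd f l - 1"
    and nz: "fps_nth (f 0) 0 \<noteq> 0"
  shows "f has_prod Abs_fps (\<lambda>n. fps_nth (\<Prod>i\<le>n. f i) n)" (is "_ has_prod ?P")
proof -
  have mult_stable: "fps_nth (A * f l) n = fps_nth A n" if "n < l" for A l n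
  proof -
    obtain c where c: "f l - 1 = fps_X ^ l * c" using dvd[of l] by blast
    have "A * f l = A + fps_X ^ l * (A * c)"
    proof -
      have "f l = 1 + fps_X ^ l * c" using c by (simp add: algebra_simps)
      then show ?thesis by (simp add: algebra_simps)
    qed
    then show ?thesis using that by (simp add: fps_X_power_mult_nth)
  qed
  have stable: "fps_nth (\<Prod>i\<le>N. f i) n = fps_nth (\<Prod>i\<le>n. f i) n" if "n \<le> N" for n N
    using that
  proof (induction N rule: dec_induct)
    case (step N)
    have "(\<Prod>i\<le>Suc N. f i) = (\<Prod>i\<le>N. f i) * f (Suc N)" by simp
    then show ?case using step mult_stable[of n "Suc N" "\<Prod>i\<le>N. f i"]
      by (metis le_imp_less_Suc)
  qed simp
  have "(\<lambda>n. \<Prod>i\<le>n. f i) \<longlonglongrightarrow> ?P"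
  proof (rule tendsto_fpsI)
    fix n
    show "eventually (\<lambda>N. fps_nth (\<Prod>i\<le>N. f i) n = fps_nth ?P n) sequentially"
      using eventually_ge_at_top[of n] by eventually_elim (simp only: fps_nth_Abs_fps, rule stable)
  qed
  moreover have "?P \<noteq> 0"
  proof
    assume "?P = 0"
    then have "fps_nth ?P 0 = 0" by simp
    then show False using nz by simp
  qed
  ultimately show ?thesis by (simp add: has_prod_def raw_has_prod_def)
qed

lemma qpoch_inf_has_prod: "(\<lambda>n. 1 - fps_X ^ (n + 1)) has_prod qpoch_inf"
  and qpoch_inf_nth_0: "fps_nth qpoch_inf 0 = 1"
proof -
  let ?f = "\<lambda>n. 1 - fps_X ^ (n + 1) :: rat fps"
  have hp: "?f has_prod Abs_fps (\<lambda>n. fps_nth (\<Prod>i\<le>n. ?f i) n)"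
    by (rule has_prod_fpsI) auto
  then have eq: "qpoch_inf = Abs_fps (\<lambda>n. fps_nth (\<Prod>i\<le>n. ?f i) n)"
    unfolding qpoch_inf_def by (rule has_prod_unique[symmetric])
  show "?f has_prod qpoch_inf" using hp eq by simp
  show "fps_nth qpoch_inf 0 = 1" by (simp add: eq)
qed

lemma dvd_power_minus_one:
  fixes a d :: "'a :: comm_ring_1"
  assumes "d dvd a - 1"
  shows "d dvd a ^ k - 1"
proof (induction k)
  case (Suc k)
  have "a ^ Suc k - 1 = (a - 1) * a ^ k + (a ^ k - 1)" by (simp add: algebra_simps)
  then show ?case using Suc assms by (metis dvd_add dvd_mult2)
qed simp

lemma frob_prod_has_prod: "frob_factor k has_prod frob_prod k"
proof -
  have dvd: "fps_X ^ l dvd frob_factor k l - 1" for l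
  proof -
    let ?a = "(1 + fps_const fls_X * fps_X ^ (l + 1)) ^ k :: rat fls fps"
    let ?b = "(1 + fps_const fls_X_inv * fps_X ^ l) ^ k :: rat fls fps"
    have "fps_X ^ l dvd ?a - 1" "fps_X ^ l dvd ?b - 1"
      by (rule dvd_power_minus_one; simp)+
    moreover have "frob_factor k l - 1 = (?a - 1) * ?b + (?b - 1)"
      by (simp add: frob_factor_def algebra_simps)
    ultimately show ?thesis by (metis dvd_add dvd_mult2)
  qed
  have "fls_nth (1 + fls_X_inv :: rat fls) 0 = 1" by simp
  then have "(1 + fls_X_inv :: rat fls) \<noteq> 0" by (auto simp: fls_eq_iff intro!: exI[of _ 0])
  then have nz: "fps_nth (frob_factor k 0) 0 \<noteq> 0"
    by (simp add: frob_factor_def fps_power_zeroth)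
  note hp = has_prod_fpsI[of "frob_factor k", OF dvd nz]
  show ?thesis
    unfolding frob_prod_def using hp by (subst has_prod_unique[OF hp, symmetric])
qed

lemma square_sum_pairs:
  fixes m :: "nat \<Rightarrow> int"
  shows "(\<Sum>i=1..n. m i)\<^sup>2 = (\<Sum>i=1..n. (m i)\<^sup>2) + 2 * (\<Sum>i=1..n. \<Sum>j=i+1..n. m i * m j)"
proof (induction n)
  case (Suc n)
  have "(\<Sum>i=1..Suc n. \<Sum>j=i+1..Suc n. m i * m j)
      = (\<Sum>i=1..n. (\<Sum>j=i+1..n. m i * m j) + m i * m (Suc n))"
    by (simp add: sum.distrib)
  also have "\<dots> = (\<Sum>i=1..n. \<Sum>j=i+1..n. m i * m j) + (\<Sum>i=1..n. m i) * m (Suc n)"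
    by (simp add: sum.distrib sum_distrib_right)
  finally show ?case using Suc by (simp add: power2_sum algebra_simps)
qed simp

lemma two_Q_form:
  "2 * Q_form k \<alpha> m = (\<Sum>i=1..k-1. (m i)\<^sup>2) + (\<alpha> - (\<Sum>i=1..k-1. m i))\<^sup>2 + \<alpha>"
proof -
  have "even (\<alpha>\<^sup>2 + \<alpha>)" by simp
  then have "2 * ((\<alpha>\<^sup>2 + \<alpha>) div 2) = \<alpha>\<^sup>2 + \<alpha>" by simp
  then show ?thesis
    using square_sum_pairs[of m "k - 1"]
    by (simp add: Q_form_def power2_diff algebra_simps)
qed

lemma abs_le_square_int: "\<bar>x\<bar> \<le> x\<^sup>2" for x :: int
proof (cases "x = 0")
  case False
  then have "\<bar>x\<bar> * 1 \<le> \<bar>x\<bar> * \<bar>x\<bar>" by (intro mult_left_mono) auto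
  then show ?thesis by (simp add: power2_eq_square)
qed simp

lemma Q_form_nonneg: "Q_form k \<alpha> m \<ge> 0"
proof -
  have sq: "x \<le> x\<^sup>2" "- x \<le> x\<^sup>2" for x :: int
  proof -
    have "\<bar>x\<bar> \<le> x\<^sup>2" by (rule abs_le_square_int)
    then show "x \<le> x\<^sup>2" "- x \<le> x\<^sup>2" by auto
  qed
  have "(\<Sum>i=1..k-1. - m i) \<le> (\<Sum>i=1..k-1. (m i)\<^sup>2)" by (intro sum_mono sq)
  then have "- (\<Sum>i=1..k-1. m i) \<le> (\<Sum>i=1..k-1. (m i)\<^sup>2)" by (simp add: sum_negf)
  moreover have "- (\<alpha> - (\<Sum>i=1..k-1. m i)) \<le> (\<alpha> - (\<Sum>i=1..k-1. m i))\<^sup>2" by (rule sq)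
  ultimately show ?thesis using two_Q_form[of k \<alpha> m] by linarith
qed

lemma Q_form_summable:
  "(\<lambda>m. fps_X ^ nat (Q_form k \<alpha> m) :: rat fps) summable_on ({1..k-1} \<rightarrow>\<^sub>E UNIV)"
    (is "?F summable_on ?A")
proof -
  have fin: "finite {m \<in> ?A. fps_nth (?F m) n \<noteq> 0}" for n
  proof -
    define B where "B = 2 * int n + \<bar>\<alpha>\<bar>"
    have "{m \<in> ?A. fps_nth (?F m) n \<noteq> 0} \<subseteq> {1..k-1} \<rightarrow>\<^sub>E {-B..B}"
    proof
      fix m assume "m \<in> {m \<in> ?A. fps_nth (?F m) n \<noteq> 0}"
      then have mA: "m \<in> ?A" and "nat (Q_form k \<alpha> m) = n"
        by (auto split: if_splits)
      then have "Q_form k \<alpha> m = int n" using Q_form_nonneg[of k \<alpha> m] by linarith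
      then have le: "(\<Sum>i=1..k-1. (m i)\<^sup>2) \<le> B"
        using two_Q_form[of k \<alpha> m] zero_le_power2[of "\<alpha> - (\<Sum>i=1..k-1. m i)"]
        unfolding B_def by linarith
      have "m i \<in> {-B..B}" if "i \<in> {1..k-1}" for i
      proof -
        have "(m i)\<^sup>2 \<le> (\<Sum>i=1..k-1. (m i)\<^sup>2)"
          using that by (intro member_le_sum) auto
        with le have "(m i)\<^sup>2 \<le> B" by linarith
        moreover have "\<bar>m i\<bar> \<le> (m i)\<^sup>2" by (rule abs_le_square_int)
        ultimately show ?thesis by auto
      qed
      with mA show "m \<in> {1..k-1} \<rightarrow>\<^sub>E {-B..B}" by (auto simp: PiE_iff)
    qed
    then show ?thesis by (rule finite_subset) (intro finite_PiE; simp)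
  qed
  have "(?F has_sum Abs_fps (\<lambda>n. \<Sum>m | m \<in> ?A \<and> fps_nth (?F m) n \<noteq> 0. fps_nth (?F m) n)) ?A"
    by (rule has_sum_fpsI[OF fin]) simp
  then show ?thesis by (rule has_sum_imp_summable)
qed

end

theory Submission
  imports Defs
begin

text \<open>
  By Jacobi's triple product, \<open>(q;q)\<^sub>\<infinity> \<Prod>\<^sub>l (1 + z q\<^sup>l\<^sup>+\<^sup>1) (1 + z\<^sup>-\<^sup>1 q\<^sup>l)\<close> is the theta series
  \<open>\<Sum>\<^sub>m z\<^sup>m q\<^bsup>m(m+1)/2\<^esup>\<close>. In its \<open>k\<close>-th power the coefficient of \<open>z\<^sup>\<alpha>\<close> is the sum of
  \<open>q\<^bsup>\<Sum> m\<^sub>i(m\<^sub>i+1)/2\<^esup>\<close> over all \<open>m\<^sub>1 + \<dots> + m\<^sub>k = \<alpha>\<close>, and eliminating \<open>m\<^sub>k\<close> turns the exponent into \<open>Q\<close>.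
  The triple product is the limit of its finite form, in which the coefficient of \<open>z\<^sup>m\<close> in the
  product over \<open>l < N\<close> is \<open>q\<^bsup>m(m+1)/2\<^esup>\<close> times the Gaussian binomial coefficient of \<open>2N\<close> over \<open>N + m\<close>.
\<close>

section \<open>Coefficientwise limits and the reduction to one colour\<close>

lemma tendsto_mult_fps:
  fixes f g :: "'b \<Rightarrow> 'a :: ring_1 fps"
  assumes "(f \<longlongrightarrow> a) F" and "(g \<longlongrightarrow> b) F"
  shows "((\<lambda>x. f x * g x) \<longlongrightarrow> a * b) F"
proof (rule tendsto_fpsI)
  fix n
  have "\<forall>\<^sub>F x in F. \<forall>i\<in>{..n}. fps_nth (f x) i = fps_nth a i \<and> fps_nth (g x) i = fps_nth b i"
    using assms by (intro eventually_ball_finite ballI eventually_conj) (auto simp: tendsto_fps_iff)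
  then show "\<forall>\<^sub>F x in F. fps_nth (f x * g x) n = fps_nth (a * b) n"
    by eventually_elim (auto simp: fps_mult_nth intro!: sum.cong)
qed

lemma tendsto_power_fps:
  fixes f :: "'b \<Rightarrow> 'a :: ring_1 fps"
  assumes "(f \<longlongrightarrow> a) F"
  shows "((\<lambda>x. f x ^ k) \<longlongrightarrow> a ^ k) F"
  by (induction k) (auto intro: tendsto_mult_fps assms)

text \<open>The partial products satisfy this factor by factor, and powers are continuous.\<close>

lemma frob_prod_power: "frob_prod k = frob_prod 1 ^ k"
proof (rule LIMSEQ_unique)
  show "(\<lambda>n. \<Prod>i\<le>n. frob_factor k i) \<longlonglongrightarrow> frob_prod k"
    by (rule has_prod_imp_tendsto[OF frob_prod_has_prod])
  have "(\<lambda>n. (\<Prod>i\<le>n. frob_factor 1 i) ^ k) \<longlonglongrightarrow> frob_prod 1 ^ k"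
    by (intro tendsto_power_fps has_prod_imp_tendsto[OF frob_prod_has_prod])
  moreover have "frob_factor k i = frob_factor 1 i ^ k" for i
    by (simp add: frob_factor_def power_mult_distrib)
  ultimately show "(\<lambda>n. \<Prod>i\<le>n. frob_factor k i) \<longlonglongrightarrow> frob_prod 1 ^ k"
    by (simp add: prod_power_distrib)
qed

subsection \<open>Coefficients with respect to \<open>z\<close>\<close>

text \<open>The extraction used in \<open>CPhi\<close>, made available for partial products and for
  \<open>theta\<close>.\<close>

definition zcoeff :: "int \<Rightarrow> rat fls fps \<Rightarrow> rat fps" where
  "zcoeff m A = Abs_fps (\<lambda>n. fls_nth (fps_nth A n) m)"

lemma zcoeff_add: "zcoeff m (A + B) = zcoeff m A + zcoeff m B"
  by (simp add: zcoeff_def fps_eq_iff)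

lemma zcoeff_one: "zcoeff m 1 = (if m = 0 then 1 else 0)"
  by (simp add: zcoeff_def fps_eq_iff)

lemma zcoeff_fps_X_power_mult: "zcoeff m (fps_X ^ a * A) = fps_X ^ a * zcoeff m A"
  by (simp add: zcoeff_def fps_eq_iff fps_X_power_mult_nth)

lemma zcoeff_z_mult: "zcoeff m (fps_const fls_X * A) = zcoeff (m - 1) A"
  by (simp add: zcoeff_def fps_eq_iff fls_X_times_conv_shift)

lemma zcoeff_z_inv_mult: "zcoeff m (fps_const fls_X_inv * A) = zcoeff (m + 1) A"
  by (simp add: zcoeff_def fps_eq_iff fls_X_inv_times_conv_shift)

lemma tendsto_zcoeff:
  assumes "(f \<longlongrightarrow> A) F"
  shows "((\<lambda>x. zcoeff m (f x)) \<longlongrightarrow> zcoeff m A) F"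
proof (rule tendsto_fpsI)
  fix n
  have "\<forall>\<^sub>F x in F. fps_nth (f x) n = fps_nth A n"
    using assms by (simp add: tendsto_fps_iff)
  then show "\<forall>\<^sub>F x in F. fps_nth (zcoeff m (f x)) n = fps_nth (zcoeff m A) n"
    by eventually_elim (simp add: zcoeff_def)
qed

text \<open>Embeds series in q as series constant in z; \<open>zcoeff\<close> is linear over these
  scalars.\<close>

definition fps_lift :: "rat fps \<Rightarrow> rat fls fps" where
  "fps_lift a = Abs_fps (\<lambda>n. fls_const (fps_nth a n))"

lemma zcoeff_fps_lift_mult: "zcoeff m (fps_lift a * B) = a * zcoeff m B"
  by (simp add: zcoeff_def fps_lift_def fps_eq_iff fps_mult_nth fls_nth_sum)

lemma zcoeff_fps_lift_power_mult: "zcoeff m (fps_lift a ^ k * B) = a ^ k * zcoeff m B"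
  by (induction k) (simp_all add: mult.assoc zcoeff_fps_lift_mult)

lemma fps_eq_zcoeffI:
  assumes "\<And>m. zcoeff m A = zcoeff m B"
  shows "A = B"
  using assms by (simp add: zcoeff_def fps_eq_iff fls_eq_iff)

subsection \<open>The Jacobi triple product\<close>

text \<open>The division is exact and \<open>nat\<close> does not truncate, also for negative
  \<open>m\<close>; see \<open>two_triangle\<close>.\<close>

definition int_triangle :: "int \<Rightarrow> nat" where
  "int_triangle m = nat ((m\<^sup>2 + m) div 2)"

lemma two_triangle: "2 * int (int_triangle m) = m\<^sup>2 + m"
proof -
  have "2 * ((m\<^sup>2 + m) div 2) = m\<^sup>2 + m" by simp
  moreover have "m\<^sup>2 + m \<ge> 0" using abs_le_square_int[of m] by linarith
  ultimately show ?thesis by (simp add: int_triangle_def)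
qed

lemma int_triangle_succ: "int (int_triangle (m + 1)) = int (int_triangle m) + m + 1"
  using two_triangle[of m] two_triangle[of "m + 1"] by (simp add: power2_sum)

lemma int_triangle_pred: "int (int_triangle (m - 1)) = int (int_triangle m) - m"
  using int_triangle_succ[of "m - 1"] by simp

definition qpoch :: "nat \<Rightarrow> rat fps" where
  "qpoch n = (\<Prod>i<n. 1 - fps_X ^ (i + 1))"

lemma qpoch_Suc: "qpoch (Suc n) = qpoch n * (1 - fps_X ^ Suc n)"
  by (simp add: qpoch_def)

lemma qpoch_nth_0: "fps_nth (qpoch n) 0 = 1"
  by (induction n) (simp_all add: qpoch_Suc qpoch_def)

lemma qpoch_tendsto: "qpoch \<longlonglongrightarrow> qpoch_inf"
  unfolding qpoch_def by (rule has_prod_imp_tendsto'[OF qpoch_inf_has_prod])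

text \<open>
  Extending \<open>1 / (q;q)\<^sub>j\<close> by \<open>0\<close> to negative \<open>j\<close> keeps its recurrence valid for all
  integers \<open>j\<close>, since the factor \<open>1 - q\<^sup>j\<close> vanishes at \<open>j = 0\<close>.
\<close>

definition qpoch_recip :: "int \<Rightarrow> rat fps" where
  "qpoch_recip j = (if j < 0 then 0 else inverse (qpoch (nat j)))"

lemma qpoch_recip_neg: "j < 0 \<Longrightarrow> qpoch_recip j = 0"
  by (simp add: qpoch_recip_def)

lemma qpoch_recip_pred: "qpoch_recip (j - 1) = (1 - fps_X ^ nat j) * qpoch_recip j"
proof (cases "j \<ge> 1")
  case True
  define n where "n = nat (j - 1)"
  have j: "nat j = Suc n" using True by (simp add: n_def)
  have "fps_nth (1 - fps_X ^ Suc n :: rat fps) 0 \<noteq> 0" by simp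
  then have "(1 - fps_X ^ Suc n :: rat fps) * inverse (1 - fps_X ^ Suc n) = 1"
    by (metis inverse_mult_eq_1')
  then have "(1 - fps_X ^ Suc n) * inverse (qpoch (Suc n)) = inverse (qpoch n)"
    by (simp only: qpoch_Suc fps_inverse_mult mult.left_commute mult_1_right)
  then show ?thesis using True by (simp add: qpoch_recip_def j n_def del: power_Suc)
next
  case False
  then show ?thesis by (cases "j = 0") (auto simp: qpoch_recip_def)
qed

lemma qpoch_recip_mult: "j \<ge> 0 \<Longrightarrow> qpoch_recip j * qpoch (nat j) = 1"
  by (simp add: qpoch_recip_def inverse_mult_eq_1 qpoch_nth_0)

section \<open>The finite triple product\<close>

lemma zcoeff_frob_factor_mult:
  "zcoeff m (A * frob_factor 1 l) =
     (1 + fps_X ^ (2 * l + 1)) * zcoeff m A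
     + fps_X ^ (l + 1) * zcoeff (m - 1) A + fps_X ^ l * zcoeff (m + 1) A"
proof -
  let ?z = "fps_const fls_X :: rat fls fps" and ?w = "fps_const fls_X_inv :: rat fls fps"
  \<comment> \<open>Abstract ring elements leave \<open>z * w = 1\<close> as the only relation to
    use; \<open>Q\<close> stands for q^l.\<close>
  have expand: "B * ((1 + z * (q * Q)) * (1 + w * Q)) =
      B + q * (Q * Q) * B + q * Q * (z * B) + Q * (w * B)"
    if "z * w = 1" for B z w q Q :: "rat fls fps"
    using that by algebra
  have "?z * ?w = 1" by (simp add: fls_X_times_conv_shift)
  from expand[OF this, of A fps_X "fps_X ^ l"] have "A * frob_factor 1 l =
      A + fps_X ^ (2 * l + 1) * A + fps_X ^ (l + 1) * (?z * A) + fps_X ^ l * (?w * A)"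
    by (simp add: frob_factor_def mult_2 power_add)
  then show ?thesis
    by (simp only: zcoeff_add zcoeff_fps_X_power_mult zcoeff_z_mult zcoeff_z_inv_mult)
      (simp only: distrib_right mult_1_left)
qed

text \<open>This is what remains of the three-term recurrence for the coefficients once
  \<open>qpoch (2 * N)\<close> and the two reciprocals at level \<open>N + 1\<close> are factored
  out.\<close>

lemma finite_triple_product_step:
  assumes "- int N - 1 \<le> m" and "m \<le> int N + 1"
  defines "a \<equiv> nat (int N + 1 - m)" and "b \<equiv> nat (int N + 1 + m)"
  shows "(1 + fps_X ^ (2 * N + 1)) * fps_X ^ int_triangle m * (1 - fps_X ^ a) * (1 - fps_X ^ b)
    + fps_X ^ (N + 1) * fps_X ^ int_triangle (m - 1)
        * ((1 - fps_X ^ nat (int N + m)) * (1 - fps_X ^ b))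
    + fps_X ^ N * fps_X ^ int_triangle (m + 1)
        * ((1 - fps_X ^ nat (int N - m)) * (1 - fps_X ^ a))
    = (fps_X ^ int_triangle m * (1 - fps_X ^ (2 * N + 1)) * (1 - fps_X ^ (2 * N + 2)) :: rat fps)"
proof -
  let ?q = "fps_X :: rat fps"
  have Ta: "?q ^ (N + 1) * ?q ^ int_triangle (m - 1) = ?q ^ int_triangle m * ?q ^ a"
    using int_triangle_pred[of m] assms(1,2)
    by (simp only: power_add[symmetric] a_def) (rule arg_cong[of _ _ "power ?q"], linarith)
  have Tb: "?q ^ N * ?q ^ int_triangle (m + 1) = ?q ^ int_triangle m * ?q ^ b"
    using int_triangle_succ[of m] assms(1,2)
    by (simp only: power_add[symmetric] b_def) (rule arg_cong[of _ _ "power ?q"], linarith)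
  have ab: "?q ^ (2 * N + 2) = ?q ^ a * ?q ^ b"
    using assms(1,2)
    by (simp only: power_add[symmetric] a_def b_def) (rule arg_cong[of _ _ "power ?q"], linarith)
  consider "a = 0" | "b = 0" | "a > 0" "b > 0" by blast
  then show ?thesis
  proof cases
    case 1
    then have m: "m = int N + 1" using assms(1,2) by (simp add: a_def)
    then have "b = 2 * N + 2" "nat (int N + m) = 2 * N + 1" by (simp_all add: b_def)
    then show ?thesis unfolding Ta Tb using 1 by (simp add: algebra_simps)
  next
    case 2
    then have m: "m = - int N - 1" using assms(1,2) by (simp add: b_def)
    then have "a = 2 * N + 2" "nat (int N - m) = 2 * N + 1" by (simp_all add: a_def)
    then show ?thesis unfolding Ta Tb using 2 by (simp add: algebra_simps)
  next
    case 3
    then obtain c d where c: "a = Suc c" and d: "b = Suc d" by (meson gr0_implies_Suc)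
    then have "nat (int N - m) = c" "nat (int N + m) = d" by (simp_all add: a_def b_def)
    moreover have "2 * N + 1 = Suc (c + d)"
      using c d assms(1,2) by (simp add: a_def b_def)
    \<comment> \<open>Here \<open>x\<close>, \<open>y\<close> stand for q^(N-m), q^(N+m), and
      \<open>t\<close> for q to the power \<open>int_triangle m\<close>.\<close>
    moreover have "(1 + ?q * (x * y)) * t * (1 - ?q * x) * (1 - ?q * y)
        + t * (?q * x) * ((1 - y) * (1 - ?q * y)) + t * (?q * y) * ((1 - x) * (1 - ?q * x))
        = t * (1 - ?q * (x * y)) * (1 - ?q * x * (?q * y))" for t x y
      by algebra
    ultimately show ?thesis
      unfolding Ta Tb ab c d by (simp only: power_Suc power_add)
  qed
qed

lemma finite_triple_product:
  "zcoeff m (\<Prod>l<N. frob_factor 1 l) =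
     fps_X ^ int_triangle m * qpoch (2 * N) * qpoch_recip (int N - m) * qpoch_recip (int N + m)"
proof (induction N arbitrary: m)
  case 0
  show ?case
    by (cases "m = 0") (auto simp: zcoeff_one int_triangle_def qpoch_def qpoch_recip_def)
next
  case (Suc N)
  \<comment> \<open>The reciprocals needed at \<open>m - 1\<close>, \<open>m\<close> and
    \<open>m + 1\<close> are all multiples of \<open>R\<close> or \<open>S\<close>, so
    \<open>R * S\<close> factors out and a polynomial identity remains.\<close>
  define R S where "R = qpoch_recip (int N + 1 - m)" and "S = qpoch_recip (int N + 1 + m)"
  define a b where "a = nat (int N + 1 - m)" and "b = nat (int N + 1 + m)"
  let ?q = "fps_X :: rat fps"
  have R1: "qpoch_recip (int N - m) = (1 - ?q ^ a) * R"
    using qpoch_recip_pred[of "int N + 1 - m"] by (simp add: R_def a_def algebra_simps)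
  have R2: "qpoch_recip (int N - (m + 1)) = (1 - ?q ^ nat (int N - m)) * ((1 - ?q ^ a) * R)"
    by (simp only: diff_diff_eq[symmetric] qpoch_recip_pred R1)
  have S1: "qpoch_recip (int N + m) = (1 - ?q ^ b) * S"
    using qpoch_recip_pred[of "int N + 1 + m"] by (simp add: S_def b_def algebra_simps)
  have S2: "qpoch_recip (int N + (m - 1)) = (1 - ?q ^ nat (int N + m)) * ((1 - ?q ^ b) * S)"
    by (simp only: add_diff_eq qpoch_recip_pred S1)
  have R0: "qpoch_recip (int N - (m - 1)) = R" and S0: "qpoch_recip (int N + (m + 1)) = S"
    by (simp_all add: R_def S_def algebra_simps)
  have "zcoeff m (\<Prod>l<Suc N. frob_factor 1 l) =
      ((1 + ?q ^ (2 * N + 1)) * ?q ^ int_triangle m * (1 - ?q ^ a) * (1 - ?q ^ b)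
      + ?q ^ (N + 1) * ?q ^ int_triangle (m - 1) * ((1 - ?q ^ nat (int N + m)) * (1 - ?q ^ b))
      + ?q ^ N * ?q ^ int_triangle (m + 1) * ((1 - ?q ^ nat (int N - m)) * (1 - ?q ^ a)))
      * (qpoch (2 * N) * R * S)" (is "_ = ?E * _")
    unfolding prod.lessThan_Suc zcoeff_frob_factor_mult Suc.IH R0 S0 R1 R2 S1 S2
    by (simp only: distrib_left distrib_right mult_ac)
  also have "\<dots> = ?q ^ int_triangle m * qpoch (2 * Suc N) * R * S"
  proof (cases "- int N - 1 \<le> m \<and> m \<le> int N + 1")
    case True
    then have "?E = ?q ^ int_triangle m * (1 - ?q ^ (2 * N + 1)) * (1 - ?q ^ (2 * N + 2))"
      unfolding a_def b_def by (intro finite_triple_product_step) auto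
    then show ?thesis by (simp only: mult_Suc_right add_2_eq_Suc qpoch_Suc) (simp add: mult_ac)
  next
    case False
    \<comment> \<open>Outside the range one of the two indices is negative, and both sides
      vanish.\<close>
    then have "R = 0 \<or> S = 0" by (auto simp: R_def S_def qpoch_recip_neg)
    then show ?thesis by auto
  qed
  finally show ?case by (simp add: R_def S_def algebra_simps)
qed

lemma qpoch_inf_nonzero: "qpoch_inf \<noteq> 0"
  using qpoch_inf_nth_0 by force

text \<open>Clearing denominators in the finite form before letting \<open>N\<close> tend to
  infinity avoids limits of inverses; one factor \<open>qpoch_inf\<close> then cancels.\<close>

lemma jacobi_triple_product: "qpoch_inf * zcoeff m (frob_prod 1) = fps_X ^ int_triangle m"
proof -
  let ?p = "\<lambda>N. zcoeff m (\<Prod>l<N. frob_factor 1 l)"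
  have shift: "(\<lambda>N. qpoch (nat (int N + j))) \<longlonglongrightarrow> qpoch_inf" for j
  proof (rule filterlim_compose[OF qpoch_tendsto])
    show "filterlim (\<lambda>N. nat (int N + j)) at_top at_top"
      unfolding filterlim_at_top
    proof
      fix Z
      show "\<forall>\<^sub>F N in at_top. Z \<le> nat (int N + j)"
        using eventually_ge_at_top[of "nat (int Z - j)"] by eventually_elim linarith
    qed
  qed
  have p: "?p \<longlonglongrightarrow> zcoeff m (frob_prod 1)"
    by (intro tendsto_zcoeff has_prod_imp_tendsto' frob_prod_has_prod)
  have lhs: "(\<lambda>N. ?p N * qpoch (nat (int N + (- m))) * qpoch (nat (int N + m)))
      \<longlonglongrightarrow> zcoeff m (frob_prod 1) * qpoch_inf * qpoch_inf"
    by (intro tendsto_mult_fps p shift)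
  have "(\<lambda>N. qpoch (2 * N)) \<longlonglongrightarrow> qpoch_inf"
    by (rule filterlim_compose[OF qpoch_tendsto]) (simp add: filterlim_subseq strict_mono_def)
  then have rhs: "(\<lambda>N. fps_X ^ int_triangle m * qpoch (2 * N)) \<longlonglongrightarrow> fps_X ^ int_triangle m * qpoch_inf"
    by (intro tendsto_mult_fps tendsto_const)
  \<comment> \<open>The identity holds once \<open>N\<close> is at least |m|, when both reciprocals
    are genuine.\<close>
  have "\<forall>\<^sub>F N in sequentially. fps_X ^ int_triangle m * qpoch (2 * N) =
      ?p N * qpoch (nat (int N + (- m))) * qpoch (nat (int N + m))"
    using eventually_ge_at_top[of "nat \<bar>m\<bar>"]
  proof eventually_elim
    case (elim N)
    have "?p N * qpoch (nat (int N + (- m))) * qpoch (nat (int N + m)) =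
        fps_X ^ int_triangle m * qpoch (2 * N)
        * (qpoch_recip (int N - m) * qpoch (nat (int N - m)))
        * (qpoch_recip (int N + m) * qpoch (nat (int N + m)))"
      unfolding finite_triple_product by (simp add: mult_ac)
    moreover have "int N - m \<ge> 0" "int N + m \<ge> 0" using elim by linarith+
    ultimately show ?case by (simp add: qpoch_recip_mult)
  qed
  then have "(\<lambda>N. ?p N * qpoch (nat (int N + (- m))) * qpoch (nat (int N + m)))
      \<longlonglongrightarrow> fps_X ^ int_triangle m * qpoch_inf"
    using rhs by (rule Lim_transform_eventually[rotated])
  from LIMSEQ_unique[OF lhs this] show ?thesis
    using qpoch_inf_nonzero by (simp add: mult_ac)
qed

subsection \<open>Powers of the theta series\<close>

text \<open>For each \<open>n\<close> the inner sum is finite (\<open>finite_triangle\<close>),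
  hence a Laurent polynomial in z.\<close>

definition theta :: "rat fls fps" where
  "theta = Abs_fps (\<lambda>n. \<Sum>m | int_triangle m = n. fls_X_intpow m)"

text \<open>The reflection of \<open>m\<close> to \<open>-m - 1\<close> fixes
  \<open>int_triangle\<close> and exchanges the two bounds, which make its fibres finite.\<close>

lemma int_triangle_bounds: "- int (int_triangle m) - 1 \<le> m" "m \<le> int (int_triangle m)"
proof -
  have "m \<le> m\<^sup>2" using abs_le_square_int[of m] by linarith
  then show "m \<le> int (int_triangle m)" using two_triangle[of m] by linarith
  have "- (m + 1) \<le> (m + 1)\<^sup>2" using abs_le_square_int[of "m + 1"] by linarith
  then show "- int (int_triangle m) - 1 \<le> m"
    using two_triangle[of m] by (simp add: power2_sum)
qed

lemma finite_triangle: "finite {m. int_triangle m = n}"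
proof (rule finite_subset)
  show "{m. int_triangle m = n} \<subseteq> {- int n - 1..int n}" using int_triangle_bounds by fastforce
qed simp

text \<open>These tuples index the terms of \<open>theta ^ k\<close> with q-exponent
  \<open>n\<close>; extensionality makes each tuple occur once.\<close>

definition lattice_fibre :: "nat \<Rightarrow> nat \<Rightarrow> (nat \<Rightarrow> int) set" where
  "lattice_fibre k n = {m \<in> {1..k} \<rightarrow>\<^sub>E UNIV. (\<Sum>i=1..k. int_triangle (m i)) = n}"

lemma finite_lattice_fibre: "finite (lattice_fibre k n)"
proof (rule finite_subset)
  show "lattice_fibre k n \<subseteq> {1..k} \<rightarrow>\<^sub>E {- int n - 1..int n}"
  proof
    fix m assume m: "m \<in> lattice_fibre k n"
    have "m i \<in> {- int n - 1..int n}" if "i \<in> {1..k}" for i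
    proof -
      have "int_triangle (m i) \<le> (\<Sum>i=1..k. int_triangle (m i))"
        using that by (intro member_le_sum) auto
      then have "int_triangle (m i) \<le> n" using m by (simp add: lattice_fibre_def)
      then show ?thesis using int_triangle_bounds[of "m i"] by auto
    qed
    then show "m \<in> {1..k} \<rightarrow>\<^sub>E {- int n - 1..int n}"
      using m by (auto simp: lattice_fibre_def PiE_iff)
  qed
qed (intro finite_PiE; simp)

lemma zcoeff_theta: "zcoeff m theta = fps_X ^ int_triangle m"
proof (rule fps_ext)
  fix n
  have "fps_nth (zcoeff m theta) n = (\<Sum>j | int_triangle j = n. if j = m then 1 else 0)"
    by (auto simp: zcoeff_def theta_def fls_nth_sum intro!: sum.cong)
  also have "\<dots> = fps_nth (fps_X ^ int_triangle m) n"
    using finite_triangle[of n] by auto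
  finally show "fps_nth (zcoeff m theta) n = fps_nth (fps_X ^ int_triangle m) n" .
qed

lemma theta_power_nth:
  "fps_nth (theta ^ k) n = (\<Sum>m\<in>lattice_fibre k n. fls_X_intpow (\<Sum>i=1..k. m i))"
proof (induction k arbitrary: n)
  case 0
  have "lattice_fibre 0 n = (if n = 0 then {\<lambda>_. undefined} else {})"
    by (auto simp: lattice_fibre_def)
  then show ?case by simp
next
  case (Suc k)
  let ?z = "fls_X_intpow :: int \<Rightarrow> rat fls"
  have "fps_nth (theta ^ Suc k) n = (\<Sum>a=0..n. fps_nth (theta ^ k) a * fps_nth theta (n - a))"
    by (simp only: power_Suc2 fps_mult_nth)
  also have "\<dots> = (\<Sum>a=0..n. \<Sum>(m, j)\<in>lattice_fibre k a \<times> {j. int_triangle j = n - a}.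
      ?z ((\<Sum>i=1..k. m i) + j))"
    unfolding Suc.IH
    by (simp only: theta_def fps_nth_Abs_fps sum_product sum.cartesian_product
        fls_X_intpow_times_fls_X_intpow)
  also have "\<dots> = (\<Sum>(a, m, j)\<in>(SIGMA a:{0..n}. lattice_fibre k a \<times> {j. int_triangle j = n - a}).
      ?z ((\<Sum>i=1..k. m i) + j))"
    by (subst sum.Sigma) (auto simp: finite_lattice_fibre finite_triangle)
  also have "\<dots> = (\<Sum>m\<in>lattice_fibre (Suc k) n. ?z (\<Sum>i=1..Suc k. m i))"
  \<comment> \<open>A triple glues to one longer tuple by appending \<open>j\<close>; its first
    entry \<open>a\<close> is recovered as the q-exponent of the first \<open>k\<close>
    coordinates.\<close>
  proof (rule sum.reindex_bij_witness[where
        i = "\<lambda>m. (\<Sum>i=1..k. int_triangle (m i), restrict m {1..k}, m (Suc k))" and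
        j = "\<lambda>(a, m, j). m(Suc k := j)"], goal_cases)
    case (1 x)
    then show ?case by (auto simp: lattice_fibre_def PiE_iff fun_eq_iff extensional_def)
  next
    case (2 x)
    then show ?case by (auto simp: lattice_fibre_def PiE_iff extensional_def)
  next
    case (3 m)
    then show ?case by (auto simp: lattice_fibre_def PiE_iff fun_eq_iff extensional_def)
  next
    case (4 m)
    then show ?case by (auto simp: lattice_fibre_def)
  next
    case (5 x)
    then show ?case by auto
  qed
  finally show ?case .
qed

section \<open>From theta powers to the quadratic form\<close>

lemma theta_eq: "theta = fps_lift qpoch_inf * frob_prod 1"
  by (rule fps_eq_zcoeffI)
    (simp only: zcoeff_theta zcoeff_fps_lift_mult jacobi_triple_product)

lemma zcoeff_theta_power: "zcoeff \<alpha> (theta ^ k) = qpoch_inf ^ k * CPhi k \<alpha>"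
  by (simp only: theta_eq power_mult_distrib zcoeff_fps_lift_power_mult
      frob_prod_power[of k, symmetric] CPhi_def zcoeff_def[of _ "frob_prod k"])

text \<open>After doubling, the linear terms of all \<open>k + 1\<close> triangular numbers add up
  to \<alpha>, which matches \<open>two_Q_form\<close>.\<close>

lemma Q_form_eq_sum_triangle:
  "int (\<Sum>i=1..k. int_triangle (m i)) + int (int_triangle (\<alpha> - (\<Sum>i=1..k. m i))) = Q_form (Suc k) \<alpha> m"
proof -
  have "2 * int (\<Sum>i=1..k. int_triangle (m i)) = (\<Sum>i=1..k. (m i)\<^sup>2) + (\<Sum>i=1..k. m i)"
    by (simp add: sum_distrib_left two_triangle sum.distrib)
  then show ?thesis
    using two_Q_form[of "Suc k" \<alpha> m] two_triangle[of "\<alpha> - (\<Sum>i=1..k. m i)"] by simp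
qed

text \<open>The last coordinate may be forgotten, since the prescribed total \<alpha> determines
  it.\<close>

lemma bij_betw_lattice_fibre_slice:
  "bij_betw (\<lambda>m. restrict m {1..k})
     {m \<in> lattice_fibre (Suc k) n. (\<Sum>i=1..Suc k. m i) = \<alpha>}
     {m \<in> {1..k} \<rightarrow>\<^sub>E UNIV. nat (Q_form (Suc k) \<alpha> m) = n}" (is "bij_betw _ ?L ?R")
proof (rule bij_betw_byWitness[where
      f' = "\<lambda>m. m(Suc k := \<alpha> - (\<Sum>i=1..k. m i))"])
  let ?f = "\<lambda>m :: nat \<Rightarrow> int. restrict m {1..k}"
  have Q: "nat (Q_form (Suc k) \<alpha> m) =
      (\<Sum>i=1..k. int_triangle (m i)) + int_triangle (\<alpha> - (\<Sum>i=1..k. m i))" for m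
    by (simp only: Q_form_eq_sum_triangle[symmetric] of_nat_add[symmetric] nat_int)
  show "\<forall>m\<in>?L. (?f m)(Suc k := \<alpha> - (\<Sum>i=1..k. ?f m i)) = m"
    by (auto simp: lattice_fibre_def PiE_iff fun_eq_iff extensional_def)
  show "\<forall>m\<in>?R. ?f (m(Suc k := \<alpha> - (\<Sum>i=1..k. m i))) = m"
    by (auto simp: PiE_iff fun_eq_iff extensional_def)
  show "?f ` ?L \<subseteq> ?R"
    unfolding Q by (auto simp: lattice_fibre_def)
  show "(\<lambda>m. m(Suc k := \<alpha> - (\<Sum>i=1..k. m i))) ` ?R \<subseteq> ?L"
    unfolding Q by (auto simp: lattice_fibre_def PiE_iff extensional_def)
qed

text \<open>On both sides the coefficient of q^n counts tuples, and the preceding bijection matches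
  the counts.\<close>

lemma zcoeff_theta_power_eq_Q_form_sum:
  "zcoeff \<alpha> (theta ^ Suc k) =
     (\<Sum>\<^sub>\<infinity>m \<in> {1..k} \<rightarrow>\<^sub>E UNIV. fps_X ^ nat (Q_form (Suc k) \<alpha> m))"
proof -
  let ?A = "{1..k} \<rightarrow>\<^sub>E (UNIV :: int set)"
  let ?F = "\<lambda>m. fps_X ^ nat (Q_form (Suc k) \<alpha> m) :: rat fps"
  have supp: "{m \<in> ?A. fps_nth (?F m) n \<noteq> 0} = {m \<in> ?A. nat (Q_form (Suc k) \<alpha> m) = n}" for n
    by auto
  have nth: "fps_nth (zcoeff \<alpha> (theta ^ Suc k)) n =
      of_nat (card {m \<in> ?A. nat (Q_form (Suc k) \<alpha> m) = n})" for n
  proof -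
    have "fps_nth (zcoeff \<alpha> (theta ^ Suc k)) n =
        (\<Sum>m\<in>lattice_fibre (Suc k) n. if (\<Sum>i=1..Suc k. m i) = \<alpha> then 1 else 0)"
      unfolding zcoeff_def fps_nth_Abs_fps theta_power_nth fls_nth_sum
      by (intro sum.cong) auto
    also have "\<dots> = of_nat (card {m \<in> lattice_fibre (Suc k) n. (\<Sum>i=1..Suc k. m i) = \<alpha>})"
      by (subst sum.inter_filter[symmetric]) (simp_all add: finite_lattice_fibre)
    finally show ?thesis unfolding bij_betw_same_card[OF bij_betw_lattice_fibre_slice] .
  qed
  have "(?F has_sum zcoeff \<alpha> (theta ^ Suc k)) ?A"
  proof (rule has_sum_fpsI)
    fix n
    show "fps_nth (zcoeff \<alpha> (theta ^ Suc k)) n =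
        (\<Sum>m | m \<in> ?A \<and> fps_nth (?F m) n \<noteq> 0. fps_nth (?F m) n)"
      unfolding nth supp by simp
    show "finite {m \<in> ?A. fps_nth (?F m) n \<noteq> 0}"
      unfolding supp bij_betw_finite[OF bij_betw_lattice_fibre_slice, symmetric]
      using finite_lattice_fibre by simp
  qed
  then show ?thesis by (rule infsumI[symmetric])
qed

theorem theorem2:
  fixes k :: nat and \<alpha> :: int
  assumes "k > 0"
  shows "CPhi k \<alpha> =
    1 / qpoch_inf ^ k * (\<Sum>\<^sub>\<infinity>m \<in> {1..k-1} \<rightarrow>\<^sub>E UNIV. fps_X ^ nat (Q_form k \<alpha> m))"
proof -
  have "qpoch_inf ^ k * CPhi k \<alpha> =
      (\<Sum>\<^sub>\<infinity>m \<in> {1..k-1} \<rightarrow>\<^sub>E UNIV. fps_X ^ nat (Q_form k \<alpha> m))"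
    using zcoeff_theta_power_eq_Q_form_sum[of \<alpha> "k - 1"] zcoeff_theta_power[of \<alpha> k] assms by simp
  \<comment> \<open>A nonzero constant term makes the power a unit, so \<open>/\<close> is
    multiplication by its inverse.\<close>
  moreover have "fps_nth (qpoch_inf ^ k) 0 \<noteq> 0"
    by (simp add: fps_power_zeroth qpoch_inf_nth_0)
  then have "1 / qpoch_inf ^ k * qpoch_inf ^ k = 1"
    by (simp add: fps_divide_unit inverse_mult_eq_1)
  ultimately show ?thesis by (metis mult.assoc mult_1_left)
qed

end
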